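(* Let $L>0$, $c\in\mathbb R$, $\beta_0\in\mathbb R\setminus\{0\}$. For $0\le a<b\le L$ and $n\in\mathbb N^*$, let $\lambda_{1,n}=c-\frac{n^2\pi^2}{L^2}$ and $$\gamma_n(a,b)=\begin{cases}\displaystyle\beta_0\int_a^b\sin\!\big(\tfrac{n\pi}{L}s\big)\sinh(\lambda_{1,n}s)\,ds&\text{if }\lambda_{1,n}\neq0,\\[2mm]\displaystyle\beta_0\int_a^b\sin\!\big(\tfrac{n\pi}{L}s\big)\,s\,ds&\text{if }\lambda_{1,n}=0.\end{cases}$$ Let $S=\{(a,b): 0\le a<b\le L\}$ and $\hat S=\{(a,b)\in S:\gamma_n(a,b)\neq0\text{ for all }n\ge1\}$. Then $\hat S$ is dense in $S$ and has full Lebesgue measure in $S$ (i.e., $S\setminus\hat S$ has zero Lebesgue measure in $\mathbb R^2$).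
   Context: $\mathbb N^*=\{1,2,\dots\}$. The numbers $\gamma_n(a,b)$ are the coupling coefficients $\int_0^L\beta(s)\sin(\frac{n\pi}{L}s)\sinh(\lambda_{1,n}s)\,ds$ (resp. with $s$ in place of $\sinh(\lambda_{1,n}s)$ if $\lambda_{1,n}=0$) for the coupling profile $\beta=\beta_0\mathbf 1_{[a,b]}$. *)

theory Defs
  imports "HOL-Analysis.Analysis"
begin

definition lambda1 :: "real \<Rightarrow> real \<Rightarrow> nat \<Rightarrow> real" where
  "lambda1 L c n = c - (real n)\<^sup>2 * pi\<^sup>2 / L\<^sup>2"

definition coupling_coeff :: "real \<Rightarrow> real \<Rightarrow> real \<Rightarrow> nat \<Rightarrow> real \<Rightarrow> real \<Rightarrow> real" where
  "coupling_coeff L c \<beta>\<^sub>0 n a b =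
    (if lambda1 L c n \<noteq> 0
     then \<beta>\<^sub>0 * integral {a..b} (\<lambda>s. sin (real n * pi / L * s) * sinh (lambda1 L c n * s))
     else \<beta>\<^sub>0 * integral {a..b} (\<lambda>s. sin (real n * pi / L * s) * s))"

definition endpoint_pairs :: "real \<Rightarrow> (real \<times> real) set" where
  "endpoint_pairs L = {(a, b). 0 \<le> a \<and> a < b \<and> b \<le> L}"

definition good_endpoint_pairs :: "real \<Rightarrow> real \<Rightarrow> real \<Rightarrow> (real \<times> real) set" where
  "good_endpoint_pairs L c \<beta>\<^sub>0 =
    {(a, b). (a, b) \<in> endpoint_pairs L \<and> (\<forall>n\<ge>1. coupling_coeff L c \<beta>\<^sub>0 n a b \<noteq> 0)}"

end

theory Submission
  imports Defs
begin

text \<open>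
  Each bad set \<open>{(a, b). \<gamma>\<^sub>n(a, b) = 0}\<close> is part of a set \<open>{(a, b). F a = F b}\<close>, where \<open>F\<close> is
  a primitive of an integrand with finitely many zeros in \<open>(0, L)\<close>. By Rolle's theorem the level
  sets of \<open>F\<close> are finite, so Fubini's theorem makes each bad set null. Density follows because a
  null set contains no nonempty open set and the triangle of endpoint pairs is convex with
  nonempty interior.
\<close>

text \<open>Rolle's theorem puts a zero of \<open>f\<close> strictly between any two points of the
  level set. Hence a point of the level set is determined by the set of zeros that do not exceed it,
  and a finite set of zeros has only finitely many subsets.\<close>

lemma finite_level_set:
  fixes F f :: "real \<Rightarrow> real"
  assumes deriv: "\<And>x. x \<in> {a..b} \<Longrightarrow> (F has_real_derivative f x) (at x within {a..b})"
    and fin: "finite {x \<in> {a<..<b}. f x = 0}"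
  shows "finite {x \<in> {a..b}. F x = v}"
proof -
  let ?Z = "{x \<in> {a<..<b}. f x = 0}" and ?E = "{x \<in> {a..b}. F x = v}"
  have sep: "\<exists>z\<in>?Z. x < z \<and> z < y" if "x \<in> ?E" "y \<in> ?E" "x < y" for x y
  proof -
    have "continuous_on {a..b} F"
      by (rule DERIV_continuous_on) (rule deriv)
    then have cont: "continuous_on {x..y} F"
      by (rule continuous_on_subset) (use that in auto)
    have der: "(F has_real_derivative f z) (at z)" if "x < z" "z < y" for z
    proof -
      have "z \<in> {a<..<b}"
        using \<open>x \<in> ?E\<close> \<open>y \<in> ?E\<close> that by auto
      then show ?thesis
        using deriv[of z] at_within_Icc_at[of a z b] by auto
    qed
    have "F x = F y"
      using that by simp
    moreover have "F differentiable (at z)" if "x < z" "z < y" for z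
      using der[OF that] real_differentiable_def by blast
    ultimately obtain z where "x < z" "z < y" "(F has_real_derivative 0) (at z)"
      using Rolle[OF \<open>x < y\<close> _ cont] by blast
    moreover from this have "f z = 0"
      using der DERIV_unique by blast
    ultimately show ?thesis
      using that by force
  qed
  have "inj_on (\<lambda>x. {z \<in> ?Z. z \<le> x}) ?E"
  proof (rule linorder_inj_onI)
    fix x y assume "x < y" "x \<in> ?E" "y \<in> ?E"
    then obtain z where "z \<in> ?Z" "x < z" "z < y"
      using sep by blast
    then have "z \<in> {z \<in> ?Z. z \<le> y}" "z \<notin> {z \<in> ?Z. z \<le> x}"
      by auto
    then show "{z \<in> ?Z. z \<le> x} \<noteq> {z \<in> ?Z. z \<le> y}"
      by blast
  qed auto
  \<comment> \<open>Every value of this map is a subset of \<open>?Z\<close>, so its image lies in a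
    finite power set.\<close>
  moreover have "finite ((\<lambda>x. {z \<in> ?Z. z \<le> x}) ` ?E)"
    by (rule finite_subset[OF _ finite_Pow_iff[THEN iffD2, OF fin]]) auto
  ultimately show ?thesis
    by (rule finite_imageD[rotated])
qed

text \<open>The slice over a fixed first coordinate lies in a level set of \<open>F\<close>, hence
  is finite and of length zero. Integrating the slice measures gives measure zero in the
  plane.\<close>

lemma negligible_equal_value_pairs:
  fixes F :: "real \<Rightarrow> real"
  assumes cont: "continuous_on {a..b} F"
    and fin: "\<And>v. finite {x \<in> {a..b}. F x = v}"
  shows "negligible {(x, y). x \<in> {a..b} \<and> y \<in> {a..b} \<and> F x = F y}"
proof -
  let ?A = "{(x, y). x \<in> {a..b} \<and> y \<in> {a..b} \<and> F x = F y}"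
  \<comment> \<open>Closedness supplies the measurability required for slicing in the product
    measure.\<close>
  have "closed {p \<in> {a..b} \<times> {a..b}. F (fst p) - F (snd p) = 0}"
    by (intro continuous_closed_preimage_constant continuous_on_diff closed_Times closed_atLeastAtMost
        continuous_on_compose2[OF cont] continuous_on_fst continuous_on_snd continuous_on_id) auto
  moreover have "{p \<in> {a..b} \<times> {a..b}. F (fst p) - F (snd p) = 0} = ?A"
    by auto
  ultimately have "?A \<in> sets borel"
    by (simp only: borel_closed)
  then have A: "?A \<in> sets (lborel \<Otimes>\<^sub>M lborel)"
    by (simp only: lborel_prod sets_lborel)
  have slice: "emeasure lborel (Pair x -` ?A) = 0" for x
  proof -
    have "finite (Pair x -` ?A)"
      by (rule finite_subset[OF _ fin[of "F x"]]) auto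
    then show ?thesis
      by (simp add: emeasure_lborel_countable countable_finite)
  qed
  have "emeasure (lborel \<Otimes>\<^sub>M lborel) ?A = 0"
    using lborel.emeasure_pair_measure_alt[OF A] slice by simp
  then have "?A \<in> null_sets (lborel :: (real \<times> real) measure)"
    using A by (simp only: null_sets_def lborel_prod) blast
  then show ?thesis
    by (simp add: negligible_iff_null_sets null_sets_completionI)
qed

text \<open>By additivity of the integral, a vanishing integral over \<open>{x..y}\<close> means
  that the primitive based at \<open>a\<close> takes equal values at \<open>x\<close> and
  \<open>y\<close>.\<close>

lemma negligible_zero_integral_pairs:
  fixes f :: "real \<Rightarrow> real"
  assumes cont: "continuous_on {a..b} f"
    and fin: "finite {x \<in> {a<..<b}. f x = 0}"
  shows "negligible {(x, y). a \<le> x \<and> x < y \<and> y \<le> b \<and> integral {x..y} f = 0}"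
proof -
  define F where "F x = integral {a..x} f" for x
  have der: "(F has_real_derivative f x) (at x within {a..b})" if "x \<in> {a..b}" for x
    using integral_has_real_derivative[OF cont that] unfolding F_def .
  have "negligible {(x, y). x \<in> {a..b} \<and> y \<in> {a..b} \<and> F x = F y}"
    using der fin
    by (intro negligible_equal_value_pairs finite_level_set[of _ _ F f] DERIV_continuous_on) auto
  moreover have "F x = F y" if "a \<le> x" "x < y" "y \<le> b" "integral {x..y} f = 0" for x y
  proof -
    have "f integrable_on {a..y}"
      by (intro integrable_continuous_real continuous_on_subset[OF cont]) (use that in auto)
    then show ?thesis
      using Henstock_Kurzweil_Integration.integral_combine[of a x y f] that
      by (simp add: F_def)
  qed
  ultimately show ?thesis
    by (elim negligible_subset) auto
qed

lemma finite_zeros_sin: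
  fixes L :: real
  assumes "L > 0" "n \<ge> 1"
  shows "finite {s \<in> {0<..<L}. sin (real n * pi / L * s) = 0}"
proof (rule finite_subset)
  show "{s \<in> {0<..<L}. sin (real n * pi / L * s) = 0} \<subseteq> (\<lambda>i. of_int i * L / real n) ` {0..int n}"
  proof
    fix s assume s: "s \<in> {s \<in> {0<..<L}. sin (real n * pi / L * s) = 0}"
    \<comment> \<open>The sine vanishes only at integer multiples of \<open>pi\<close>, so
      \<open>s\<close> is a multiple of \<open>L / n\<close>; the bounds on \<open>s\<close> leave
      finitely many.\<close>
    then obtain i :: int where "real n * pi / L * s = of_int i * pi"
      by (auto simp: sin_zero_iff_int2)
    then have i: "real n * s = of_int i * L"
      using assms by (simp add: field_simps)
    have "0 < of_int i * L" "of_int i * L < real n * L"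
      using s assms by (auto simp flip: i)
    then have "0 < i" "i < int n"
      using assms by (auto simp: zero_less_mult_iff)
    moreover have "s = of_int i * L / real n"
      using i assms by (simp add: field_simps)
    ultimately show "s \<in> (\<lambda>i. of_int i * L / real n) ` {0..int n}"
      by auto
  qed
qed simp

lemma negligible_coupling_coeff_zero:
  assumes "L > 0" "\<beta>\<^sub>0 \<noteq> 0" "n \<ge> 1"
  shows "negligible {(a, b). (a, b) \<in> endpoint_pairs L \<and> coupling_coeff L c \<beta>\<^sub>0 n a b = 0}"
proof -
  \<comment> \<open>The factor \<open>g\<close> merges the two cases of the coefficient. In both it
    has no zero at positive \<open>s\<close>, so the zeros of the integrand in the open interval are
    those of the sine.\<close>
  define g where "g s = (if lambda1 L c n \<noteq> 0 then sinh (lambda1 L c n * s) else s)" for s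
  define f where "f s = sin (real n * pi / L * s) * g s" for s
  have "continuous_on {0..L} g"
    unfolding g_def by (cases "lambda1 L c n = 0") (auto intro: continuous_intros)
  then have cont: "continuous_on {0..L} f"
    unfolding f_def by (intro continuous_intros)
  have "g s \<noteq> 0" if "s > 0" for s
    using that by (auto simp: g_def)
  then have "{s \<in> {0<..<L}. f s = 0} = {s \<in> {0<..<L}. sin (real n * pi / L * s) = 0}"
    by (auto simp: f_def)
  then have fin: "finite {s \<in> {0<..<L}. f s = 0}"
    using finite_zeros_sin[OF \<open>L > 0\<close> \<open>n \<ge> 1\<close>] by simp
  have "coupling_coeff L c \<beta>\<^sub>0 n a b = \<beta>\<^sub>0 * integral {a..b} f" for a b
    by (simp add: coupling_coeff_def f_def[abs_def] g_def)
  then show ?thesis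
    using negligible_zero_integral_pairs[OF cont fin] \<open>\<beta>\<^sub>0 \<noteq> 0\<close>
    by (simp add: endpoint_pairs_def conj_assoc)
qed

lemma convex_endpoint_pairs: "convex (endpoint_pairs L)"
proof -
  have "endpoint_pairs L = {p. (1, 0) \<bullet> p \<ge> 0} \<inter> {p. (1, - 1) \<bullet> p < 0} \<inter> {p. (0, 1) \<bullet> p \<le> L}"
    by (auto simp: endpoint_pairs_def inner_prod_def)
  then show ?thesis
    by (simp add: convex_Int convex_halfspace_ge convex_halfspace_lt convex_halfspace_le)
qed

lemma interior_endpoint_pairs_nonempty:
  assumes "L > 0"
  shows "interior (endpoint_pairs L) \<noteq> {}"
proof -
  let ?U = "{0<..<L/2} \<times> {L/2<..<L}"
  have "?U \<subseteq> interior (endpoint_pairs L)"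
    by (rule interior_maximal) (auto simp: endpoint_pairs_def open_Times)
  moreover have "(L/3, 2*L/3) \<in> ?U"
    using assms by auto
  ultimately show ?thesis
    by blast
qed

text \<open>A neighbourhood of an interior point meets the interior in a nonempty open set, which
  \<open>N\<close> cannot cover. Convexity then reaches the boundary points of \<open>S\<close>, as
  they are limits of interior points.\<close>

lemma convex_subset_closure_Diff_negligible:
  fixes S :: "'a::euclidean_space set"
  assumes "convex S" "interior S \<noteq> {}" "negligible N"
  shows "S \<subseteq> closure (S - N)"
proof -
  have "interior S \<subseteq> closure (S - N)"
  proof
    fix x assume x: "x \<in> interior S"
    show "x \<in> closure (S - N)"
      unfolding closure_iff_nhds_not_empty
    proof (intro allI impI)
      fix A V assume "V \<subseteq> A" "open V" "x \<in> V"
      then have "\<not> negligible (V \<inter> interior S)"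
        using x by (intro open_not_negligible) auto
      then have "\<not> V \<inter> interior S \<subseteq> N"
        using \<open>negligible N\<close> negligible_subset by blast
      then show "(S - N) \<inter> A \<noteq> {}"
        using \<open>V \<subseteq> A\<close> interior_subset by blast
    qed
  qed
  then have "closure (interior S) \<subseteq> closure (S - N)"
    by (simp add: closure_minimal)
  then show ?thesis
    using convex_closure_interior[OF assms(1,2)] closure_subset by blast
qed

theorem lemma7:
  fixes L c \<beta>\<^sub>0 :: real
  assumes "L > 0" and "\<beta>\<^sub>0 \<noteq> 0"
  shows "endpoint_pairs L \<subseteq> closure (good_endpoint_pairs L c \<beta>\<^sub>0) \<and>
         endpoint_pairs L - good_endpoint_pairs L c \<beta>\<^sub>0 \<in> null_sets lebesgue"
proof -
  let ?S = "endpoint_pairs L" and ?G = "good_endpoint_pairs L c \<beta>\<^sub>0"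
  \<comment> \<open>The index set is countable, so the union of the negligible bad sets stays
    negligible.\<close>
  have "negligible (\<Union>n\<in>{1..}. {(a, b). (a, b) \<in> ?S \<and> coupling_coeff L c \<beta>\<^sub>0 n a b = 0})"
    using assms by (intro negligible_countable_Union) (auto intro!: negligible_coupling_coeff_zero)
  moreover have "?S - ?G = (\<Union>n\<in>{1..}. {(a, b). (a, b) \<in> ?S \<and> coupling_coeff L c \<beta>\<^sub>0 n a b = 0})"
    by (auto simp: good_endpoint_pairs_def)
  ultimately have neg: "negligible (?S - ?G)"
    by simp
  \<comment> \<open>Since \<open>?G\<close> lies in \<open>?S\<close>, removing the whole bad set
    from \<open>?S\<close> leaves exactly \<open>?G\<close>, and density follows from the convexity
    argument.\<close>
  have "?S - (?S - ?G) = ?G"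
    by (auto simp: good_endpoint_pairs_def)
  then have "?S \<subseteq> closure ?G"
    using convex_subset_closure_Diff_negligible
      [OF convex_endpoint_pairs interior_endpoint_pairs_nonempty[OF \<open>L > 0\<close>] neg] by simp
  with neg show ?thesis
    by (simp add: negligible_iff_null_sets)
qed

end
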